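(* Let $r\ge 1$ be an integer and let $a_1,\ldots,a_{r+1},b_1,\ldots,b_r,x,y$ be nonzero complex numbers such that the series below (with the inner series on the right expanded) converge absolutely. Then \begin{align*} &{ }_{r+1} \phi_r\left[\begin{array}{c} a_1, \ldots, a_{r+1} \\ b_1, \ldots, b_r \end{array}; q, y\right]\\ &=(x;q)_\infty\sum_{i,k\geq 0} \frac{x^kq^{ik}\tau(k)}{(q ,q,x; q)_k} \frac{(a_1,a_2,\cdots,a_{r+1};q)_{i-k}}{(q^{k+1},b_1,b_2,\cdots,b_r;q)_{i-k}}y^{i-k}\\ &\qquad\times{ }_{r+1} \phi_{r+1}\left[\begin{array}{c}0, q^{1+k-i}/b_1,q^{1+k-i}/b_2,\cdots,q^{1+k-i}/b_r\\ q^{1+k-i}/a_1,q^{1+k-i}/a_2,\cdots,q^{1+k-i}/a_{r+1} \end{array}; q, \frac{xb_1b_2\cdots b_r\,q^{1+k-i}}{ya_1a_2\cdots a_{r+1}}\right]. \end{align*}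
   Context: $q$ is a complex number with $0<|q|<1$. Notation: $(a;q)_\infty=\prod_{k\ge 0}(1-aq^k)$ and $(a;q)_n=(a;q)_\infty/(aq^n;q)_\infty$ for $n\in\mathbb{Z}$, i.e. $(a;q)_n=\prod_{k=0}^{n-1}(1-aq^k)$ and $(a;q)_{-n}=1/\prod_{k=1}^{n}(1-aq^{-k})$ for $n\ge 0$; $(a_1,\ldots,a_m;q)_n=\prod_{k=1}^m (a_k;q)_n$; $\tau(n)=(-1)^nq^{n(n-1)/2}$. The basic hypergeometric series is $${}_{r}\phi_s\left[\begin{array}{c} a_1,\ldots,a_r\\ b_1,\ldots,b_s\end{array};q,x\right]=\sum_{n=0}^\infty\frac{(a_1,\ldots,a_r;q)_n}{(b_1,\ldots,b_s;q)_n}\tau(n)^{s+1-r}\frac{x^n}{(q;q)_n}.$$ All parameters are assumed to be such that no zero factors occur in denominators. *)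

theory Defs
  imports "HOL-Analysis.Analysis"
begin

definition qpoch_inf :: "complex \<Rightarrow> complex \<Rightarrow> complex" where
  "qpoch_inf a q = (\<Prod>k. 1 - a * q ^ k)"

text \<open>
  The product form of \<open>(a;q)\<^sub>n\<close> is used because the quotient
  \<open>(a;q)\<^sub>\<infinity> / (aq\<^sup>n;q)\<^sub>\<infinity>\<close> degenerates to 0/0 when \<open>a\<close> is a suitable power of \<open>q\<close>.
  If \<open>n < 0\<close> and a factor \<open>1 - a q\<^sup>-\<^sup>k\<close> vanishes, then \<open>(a;q)\<^sub>n\<close> has a pole and
  \<open>1 / (a;q)\<^sub>n = (aq\<^sup>n;q)\<^sub>-\<^sub>n = 0\<close>; the convention \<open>1 / 0 = 0\<close> gives this same value to \<open>1 / qpoch a q n\<close>.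
\<close>
definition qpoch :: "complex \<Rightarrow> complex \<Rightarrow> int \<Rightarrow> complex" where
  "qpoch a q n =
     (if n \<ge> 0 then \<Prod>k<nat n. 1 - a * q ^ k
      else 1 / (\<Prod>k=1..nat (- n). 1 - a * q powi (- int k)))"

definition qpochs :: "complex list \<Rightarrow> complex \<Rightarrow> int \<Rightarrow> complex" where
  "qpochs as q n = (\<Prod>a\<leftarrow>as. qpoch a q n)"

definition qtau :: "complex \<Rightarrow> nat \<Rightarrow> complex" where
  "qtau q n = (-1) ^ n * q ^ (n * (n - 1) div 2)"

definition qhyp_term :: "complex list \<Rightarrow> complex list \<Rightarrow> complex \<Rightarrow> complex \<Rightarrow> nat \<Rightarrow> complex" where
  "qhyp_term as bs q x n =
     qpochs as q (int n) / qpochs bs q (int n)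
       * qtau q n powi (int (length bs) + 1 - int (length as))
       * (x ^ n / qpoch q q (int n))"

definition qhyp :: "complex list \<Rightarrow> complex list \<Rightarrow> complex \<Rightarrow> complex \<Rightarrow> complex" where
  "qhyp as bs q x = (\<Sum>n. qhyp_term as bs q x n)"

definition outer_coeff ::
  "complex list \<Rightarrow> complex list \<Rightarrow> complex \<Rightarrow> complex \<Rightarrow> complex \<Rightarrow> nat \<Rightarrow> nat \<Rightarrow> complex" where
  "outer_coeff as bs q x y i k =
     x ^ k * q ^ (i * k) * qtau q k / qpochs [q, q, x] q (int k)
       * (qpochs as q (int i - int k) / qpochs (q ^ (k + 1) # bs) q (int i - int k))
       * y powi (int i - int k)"

definition reflected :: "complex \<Rightarrow> nat \<Rightarrow> nat \<Rightarrow> complex list \<Rightarrow> complex list" where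
  "reflected q i k cs = map (\<lambda>c. q powi (1 + int k - int i) / c) cs"

definition inner_arg ::
  "complex list \<Rightarrow> complex list \<Rightarrow> complex \<Rightarrow> complex \<Rightarrow> complex \<Rightarrow> nat \<Rightarrow> nat \<Rightarrow> complex" where
  "inner_arg as bs q x y i k =
     x * prod_list bs * q powi (1 + int k - int i) / (y * prod_list as)"

end

theory Submission
  imports Defs
begin

text \<open>
  Write $A(m) = (a_1,\ldots,a_{r+1};q)_m / (b_1,\ldots,b_r;q)_m$ for all integers $m$. Reversing the
  products in the inner series turns the general term of the triple series on the right into
  \[ A(m)\, y^m \cdot \frac{x^{n+k} q^{ik} \tau(k)}{(q;q)_n (q;q)_k (q;q)_i (x;q)_k},
     \qquad m = i - k - n, \]
  so that the parameters and $y$ are present only through $m$ (\<open>rhs_term_eq\<close>). Absolute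
  convergence permits summing first over all $(n,k)$ with $m$ fixed, and everything reduces to the
  parameter-free identity \<open>coefficient_sum\<close>: the sum of the second factors is
  $1/((q;q)_m (x;q)_\infty)$, which is zero for $m < 0$. What is left is the series for
  ${}_{r+1}\phi_r$ divided by $(x;q)_\infty$.

  The identity \<open>coefficient_sum\<close> is the ${}_1\phi_1$ summation read off coefficientwise. It
  is a combination of two finite $q$-binomial identities (\<open>q_power_expansion\<close>,
  \<open>q_binomial_at_one\<close>) and of Cauchy's expansion of $1/(X;q)_\infty$
  (\<open>cauchy_sum_shifted\<close>). It requires $|x| < 1$, which is itself a consequence of the
  convergence of the triple series: the terms with $m = k = 0$ are $x^n/(q;q)_n^2$.
\<close>

section \<open>Reciprocal shifted factorials\<close>

lemma qpoch_nat: "qpoch a q (int n) = (\<Prod>k<n. 1 - a * q ^ k)"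
  by (simp add: qpoch_def)

text \<open>
  The reciprocal is the better behaved object. At a negative index the symbol itself can have a pole;
  its reciprocal is then zero, which is what $1/0 = 0$ gives. So the recurrence of the reciprocals runs
  through all integers, and \<open>rqpoch q q m\<close> is the usual $1/(q;q)_m$, zero for negative \<open>m\<close>.
\<close>

definition rqpoch :: "complex \<Rightarrow> complex \<Rightarrow> int \<Rightarrow> complex" where
  "rqpoch a q m = 1 / qpoch a q m"

lemma rqpoch_0 [simp]: "rqpoch a q 0 = 1"
  by (simp add: rqpoch_def qpoch_def)

lemma rqpoch_pred:
  assumes "q \<noteq> 0" "\<forall>n::nat. 1 - a * q ^ n \<noteq> 0"
  shows "rqpoch a q (m - 1) = (1 - a * q powi (m - 1)) * rqpoch a q m"
proof (cases "m \<ge> 1")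
  case True
  define n where "n = nat (m - 1)"
  have m: "m = int n + 1" using True by (simp add: n_def)
  have "qpoch a q m = qpoch a q (int n) * (1 - a * q ^ n)"
    using qpoch_nat[of a q "Suc n"] by (simp add: qpoch_nat m add.commute)
  then show ?thesis using assms by (simp add: rqpoch_def m)
next
  case False
  define n where "n = nat (- m)"
  have m: "m = - int n" using False by (simp add: n_def)
  have A: "rqpoch a q (- int k) = (\<Prod>k=1..k. 1 - a * q powi (- int k))" for k
    by (cases "k = 0") (simp_all add: rqpoch_def qpoch_def)
  have e: "m - 1 = - int (Suc n)" by (simp add: m)
  show ?thesis unfolding e A by (simp add: m A)
qed

lemma rqpoch_Suc:
  assumes "q \<noteq> 0" "\<forall>n::nat. 1 - a * q ^ n \<noteq> 0"
  shows "rqpoch a q m = (1 - a * q powi m) * rqpoch a q (m + 1)"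
  using rqpoch_pred[OF assms, of "m + 1"] by simp

lemma qtau_0 [simp]: "qtau q 0 = 1"
  by (simp add: qtau_def)

lemma qtau_Suc: "qtau q (Suc n) = - (q ^ n) * qtau q n"
proof -
  have "Suc n * n div 2 = n + n * (n - 1) div 2"
    by (cases n) (simp_all add: algebra_simps)
  then show ?thesis by (simp add: qtau_def power_add)
qed

lemma qtau_add: "qtau q (u + l) = qtau q u * qtau q l * q ^ (u * l)"
  by (induction l) (simp_all add: qtau_Suc power_add algebra_simps)

lemma norm_qtau_le: "norm q < 1 \<Longrightarrow> norm (qtau q n) \<le> 1"
  by (simp add: qtau_def norm_mult norm_power power_le_one)

text \<open>
  An absolutely convergent product without zero factors has a nonzero limit; hence the
  reciprocals converge too, and are bounded.
\<close>

lemma qpoch_tendsto: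
  assumes "norm q < 1" "\<forall>n::nat. 1 - a * q ^ n \<noteq> 0"
  shows "(\<lambda>n. qpoch a q (int n)) \<longlonglongrightarrow> qpoch_inf a q" "qpoch_inf a q \<noteq> 0"
proof -
  have "summable (\<lambda>k. norm (- (a * q ^ k)))"
    using assms(1) by (simp add: norm_mult norm_power summable_mult summable_geometric)
  then have c: "convergent_prod (\<lambda>k. 1 - a * q ^ k)"
    using summable_imp_convergent_prod_complex[of "\<lambda>k. - (a * q ^ k)"] assms(2) by (force simp: algebra_simps)
  show "(\<lambda>n. qpoch a q (int n)) \<longlonglongrightarrow> qpoch_inf a q"
    using convergent_prod_LIMSEQ[OF c] by (simp add: qpoch_nat qpoch_inf_def LIMSEQ_lessThan_iff_atMost)
  show "qpoch_inf a q \<noteq> 0"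
    using c assms(2) by (simp add: qpoch_inf_def prodinf_nonzero)
qed

lemma rqpoch_tendsto:
  assumes "norm q < 1" "\<forall>n::nat. 1 - a * q ^ n \<noteq> 0"
  shows "(\<lambda>n. rqpoch a q (int n)) \<longlonglongrightarrow> 1 / qpoch_inf a q"
  unfolding rqpoch_def by (intro tendsto_intros qpoch_tendsto assms)

lemma rqpoch_bound:
  assumes "norm q < 1" "\<forall>n::nat. 1 - a * q ^ n \<noteq> 0"
  obtains B where "B > 0" "\<And>n. norm (rqpoch a q (int n)) \<le> B"
  using convergent_imp_Bseq[OF convergentI[OF rqpoch_tendsto[OF assms]]] unfolding Bseq_def by auto

lemma one_minus_power_nonzero:
  fixes q :: complex
  assumes "norm q < 1"
  shows "\<forall>n::nat. 1 - q * q ^ n \<noteq> 0"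
proof
  fix n
  have "norm (q * q ^ n) < 1"
    using power_less_one_iff[of "norm q" "Suc n"] assms by (simp add: norm_mult norm_power)
  then show "1 - q * q ^ n \<noteq> 0" by auto
qed

lemma rqpoch_q_neg: assumes "q \<noteq> 0" "m < 0" shows "rqpoch q q m = 0"
proof -
  have "(\<Prod>k=1..nat (- m). 1 - q * q powi (- int k)) = 0"
    using assms by (intro prod_zero) (auto intro!: bexI[of _ 1] simp: power_int_minus)
  then show ?thesis using assms by (simp add: rqpoch_def qpoch_def)
qed

section \<open>Finite expansions\<close>

text \<open>
  Up to the factor $(q;q)_t$ this is the finite $q$-binomial expansion of $(z;q)_t$ at $z = 1$, where
  the factor $1 - z$ vanishes. Splitting $1 - q^t = q^{t-u}(1 - q^u) + (1 - q^{t-u})$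
  in each summand gives a first-order recurrence in \<open>t\<close>, whose factor $1 - q^t$ kills the value at $t = 0$.
\<close>

lemma q_binomial_at_one:
  assumes q: "0 < norm q" "norm q < 1"
  shows "(\<Sum>u\<le>t. qtau q u * rqpoch q q (int u) * rqpoch q q (int t - int u)) = (if t = 0 then 1 else 0)"
proof -
  have q0: "q \<noteq> 0" using q by auto
  note nz = one_minus_power_nonzero[OF q(2)]
  define E where "E t = (\<Sum>u\<le>t. qtau q u * rqpoch q q (int u) * rqpoch q q (int t - int u))" for t :: nat
  have rec: "(1 - q ^ Suc t) * E (Suc t) = (1 - q ^ t) * E t" for t
  proof -
    have split: "(1 - q ^ Suc t) * (qtau q u * rqpoch q q (int u) * rqpoch q q (int (Suc t) - int u))
       = qtau q u * q ^ (Suc t - u) * rqpoch q q (int u - 1) * rqpoch q q (int (Suc t) - int u)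
       + qtau q u * rqpoch q q (int u) * rqpoch q q (int t - int u)" if le: "u \<le> Suc t" for u
    proof -
      obtain v where v: "Suc t = u + v" using le_Suc_ex[OF le] by auto
      have v': "int t - int u = int v - 1" using v by linarith
      have a: "rqpoch q q (int u - 1) = (1 - q ^ u) * rqpoch q q (int u)"
        using rqpoch_pred[OF q0 nz, of "int u"] q0 by (simp add: power_int_diff)
      have b: "rqpoch q q (int v - 1) = (1 - q ^ v) * rqpoch q q (int v)"
        using rqpoch_pred[OF q0 nz, of "int v"] q0 by (simp add: power_int_diff)
      show ?thesis unfolding v v' by (simp add: a b power_add algebra_simps)
    qed
    have "(1 - q ^ Suc t) * E (Suc t) =
        (\<Sum>u\<le>Suc t. qtau q u * q ^ (Suc t - u) * rqpoch q q (int u - 1) * rqpoch q q (int (Suc t) - int u))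
      + (\<Sum>u\<le>Suc t. qtau q u * rqpoch q q (int u) * rqpoch q q (int t - int u))"
      unfolding E_def sum_distrib_left sum.distrib[symmetric] using split by (intro sum.cong) auto
    also have "(\<Sum>u\<le>Suc t. qtau q u * rqpoch q q (int u) * rqpoch q q (int t - int u)) = E t"
      using q0 by (simp add: E_def rqpoch_q_neg)
    also have "(\<Sum>u\<le>Suc t. qtau q u * q ^ (Suc t - u) * rqpoch q q (int u - 1) * rqpoch q q (int (Suc t) - int u))
       = (\<Sum>u\<le>t. qtau q (Suc u) * q ^ (t - u) * rqpoch q q (int u) * rqpoch q q (int t - int u))"
      using q0 by (subst sum.atMost_Suc_shift) (simp add: rqpoch_q_neg)
    also have "\<dots> = - (q ^ t) * E t"
      unfolding E_def sum_distrib_left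
    proof (intro sum.cong refl)
      fix u assume "u \<in> {..t}"
      then have "q ^ t = q ^ u * q ^ (t - u)" by (simp flip: power_add)
      then show "qtau q (Suc u) * q ^ (t - u) * rqpoch q q (int u) * rqpoch q q (int t - int u) =
        - (q ^ t) * (qtau q u * rqpoch q q (int u) * rqpoch q q (int t - int u))"
        by (simp add: qtau_Suc)
    qed
    finally show ?thesis by (simp add: algebra_simps)
  qed
  have "E (Suc t) = 0" for t
  proof (induction t)
    case 0
    show ?case using rec[of 0] nz[rule_format, of 0] by simp
  next
    case (Suc t)
    then show ?case using rec[of "Suc t"] nz[rule_format, of "Suc t"] by simp
  qed
  moreover have "E 0 = 1" by (simp add: E_def)
  ultimately show ?thesis unfolding E_def[symmetric] by (cases t) auto
qed

text \<open>
  This is the coefficient of $z^i$ in $1/(zq^k;q)_\infty = (z;q)_k / (z;q)_\infty$, with $(z;q)_k$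
  expanded by the $q$-binomial theorem and both sides divided by $(q;q)_k$. The induction multiplies
  the generating function by $1 - zq^k$. With an integer index \<open>i\<close> and reciprocals that vanish at negative
  indices, the range of summation need not depend on \<open>i\<close>.
\<close>

lemma q_power_expansion:
  assumes q: "0 < norm q" "norm q < 1"
  shows "q powi (i * int k) * rqpoch q q i * rqpoch q q (int k) =
    (\<Sum>s\<le>k. qtau q s * rqpoch q q (int s) * rqpoch q q (int k - int s) * rqpoch q q (i - int s))"
proof (induction k arbitrary: i)
  case 0
  show ?case by simp
next
  case (Suc k)
  have q0: "q \<noteq> 0" using q by auto
  note nz = one_minus_power_nonzero[OF q(2)]
  have pr: "rqpoch q q (j - 1) = (1 - q powi j) * rqpoch q q j" for j
    using rqpoch_pred[OF q0 nz, of j] q0 by (simp add: power_int_diff)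
  define S where "S = (\<lambda>k i. \<Sum>s\<le>k. qtau q s * rqpoch q q (int s) * rqpoch q q (int k - int s) * rqpoch q q (i - int s))"
  define L where "L = (\<lambda>k i. q powi (i * int k) * rqpoch q q i * rqpoch q q (int k))"
  have IH: "L k i = S k i" for i using Suc by (simp add: L_def S_def)
  have c: "rqpoch q q (int k) = (1 - q ^ Suc k) * rqpoch q q (int (Suc k))"
    using pr[of "int (Suc k)"] by (simp flip: power_int_of_nat add: add.commute)
  have "(1 - q ^ Suc k) * L (Suc k) i = L k i - q ^ k * L k (i - 1)"
    unfolding L_def pr
    unfolding c using q0
    by (simp add: power_int_add power_int_diff ring_distribs)
  also have "\<dots> = S k i - q ^ k * S k (i - 1)" by (simp add: IH)
  also have "\<dots> = (1 - q ^ Suc k) * S (Suc k) i"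
  proof -
    have "(1 - q ^ Suc k) * S (Suc k) i = 
      (\<Sum>s\<le>Suc k. qtau q s * rqpoch q q (int s) * rqpoch q q (int k - int s) * rqpoch q q (i - int s))
     + (\<Sum>s\<le>Suc k. qtau q s * q ^ (Suc k - s) * rqpoch q q (int s - 1) * rqpoch q q (int (Suc k) - int s) * rqpoch q q (i - int s))"
      unfolding S_def sum_distrib_left sum.distrib[symmetric]
    proof (intro sum.cong refl)
      fix s assume "s \<in> {..Suc k}"
      then obtain v where v: "Suc k = s + v" using le_Suc_ex by auto
      have v': "int k - int s = int v - 1" using v by linarith
      have a: "rqpoch q q (int s - 1) = (1 - q ^ s) * rqpoch q q (int s)" using pr[of "int s"] by simp
      have b: "rqpoch q q (int v - 1) = (1 - q ^ v) * rqpoch q q (int v)" using pr[of "int v"] by simp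
      show "(1 - q ^ Suc k) * (qtau q s * rqpoch q q (int s) * rqpoch q q (int (Suc k) - int s) * rqpoch q q (i - int s)) =
        qtau q s * rqpoch q q (int s) * rqpoch q q (int k - int s) * rqpoch q q (i - int s) +
        qtau q s * q ^ (Suc k - s) * rqpoch q q (int s - 1) * rqpoch q q (int (Suc k) - int s) * rqpoch q q (i - int s)"
        unfolding v v' by (simp add: a b power_add algebra_simps)
    qed
    also have "(\<Sum>s\<le>Suc k. qtau q s * rqpoch q q (int s) * rqpoch q q (int k - int s) * rqpoch q q (i - int s)) = S k i"
      using q0 by (simp add: S_def rqpoch_q_neg)
    also have "(\<Sum>s\<le>Suc k. qtau q s * q ^ (Suc k - s) * rqpoch q q (int s - 1) * rqpoch q q (int (Suc k) - int s) * rqpoch q q (i - int s))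
      = (\<Sum>s\<le>k. qtau q (Suc s) * q ^ (k - s) * rqpoch q q (int s) * rqpoch q q (int k - int s) * rqpoch q q (i - 1 - int s))"
      using q0 by (subst sum.atMost_Suc_shift) (simp add: rqpoch_q_neg diff_diff_eq)
    also have "\<dots> = - (q ^ k) * S k (i - 1)"
      unfolding S_def sum_distrib_left
    proof (intro sum.cong refl)
      fix s assume "s \<in> {..k}"
      then have "q ^ k = q ^ s * q ^ (k - s)" by (simp flip: power_add)
      then show "qtau q (Suc s) * q ^ (k - s) * rqpoch q q (int s) * rqpoch q q (int k - int s) * rqpoch q q (i - 1 - int s) =
        - (q ^ k) * (qtau q s * rqpoch q q (int s) * rqpoch q q (int k - int s) * rqpoch q q (i - 1 - int s))"
        by (simp add: qtau_Suc)
    qed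
    finally show ?thesis by simp
  qed
  finally have "L (Suc k) i = S (Suc k) i" using nz by simp
  then show ?case by (simp add: L_def S_def)
qed

section \<open>A form of the Cauchy identity\<close>

text \<open>
  Cauchy's identity $\sum_l X^l q^{l(l-1)} / ((q;q)_l (X;q)_l) = 1/(X;q)_\infty$ at $X = xq^u$, divided
  by $(x;q)_u$. In this normalisation the value does not depend on \<open>u\<close>: the splitting
  $1/(q;q)_l = q^l/(q;q)_l + 1/(q;q)_{l-1}$ turns the sum at \<open>u\<close> into the sum at \<open>u + 1\<close>. Hence it equals its
  limit as $u \to \infty$, where only the term $l = 0$ survives.
\<close>

lemma cauchy_sum_shifted:
  assumes q: "0 < norm q" "norm q < 1" and x: "norm x < 1" and nx: "\<forall>n::nat. 1 - x * q ^ n \<noteq> 0"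
  shows "(\<lambda>l. (x * q ^ u) ^ l * (qtau q l)\<^sup>2 * rqpoch q q (int l) * rqpoch x q (int (u + l)))
    sums (1 / qpoch_inf x q)"
proof -
  have q0: "q \<noteq> 0" using q by auto
  note nz = one_minus_power_nonzero[OF q(2)]
  have pr: "rqpoch q q (j - 1) = (1 - q powi j) * rqpoch q q j" for j
    using rqpoch_pred[OF q0 nz, of j] q0 by (simp add: power_int_diff)
  have px: "rqpoch x q (int n) = (1 - x * q ^ n) * rqpoch x q (int (Suc n))" for n
    using rqpoch_Suc[OF q0 nx, of "int n"] by (simp add: add.commute)
  obtain B where B: "B > 0" "\<And>n. norm (rqpoch q q (int n)) \<le> B" by (rule rqpoch_bound[OF q(2) nz]) blast
  obtain C where C: "C > 0" "\<And>n. norm (rqpoch x q (int n)) \<le> C" by (rule rqpoch_bound[OF q(2) nx]) blast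
  define f where "f = (\<lambda>u l. (x * q ^ u) ^ l * (qtau q l)\<^sup>2 * rqpoch q q (int l) * rqpoch x q (int (u + l)))"
  have bound: "norm (c ^ l * (qtau q l)\<^sup>2 * rqpoch q q (int l) * rqpoch x q (int j)) \<le> norm x ^ l * B * C"
    if "norm c \<le> norm x" for c l j
  proof -
    have "norm (qtau q l)^2 \<le> 1" using norm_qtau_le[OF q(2), of l] by (simp add: power_le_one)
    then have "norm (c ^ l * (qtau q l)\<^sup>2 * rqpoch q q (int l) * rqpoch x q (int j))
        \<le> norm x ^ l * 1 * B * C"
      unfolding norm_mult norm_power using B C that
      by (intro mult_mono power_mono mult_nonneg_nonneg zero_le_power norm_ge_zero) (auto intro: less_imp_le)
    then show ?thesis by simp
  qed
  have norm_xq: "norm (x * q ^ u) \<le> norm x" for u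
    using q by (simp add: norm_mult norm_power mult_left_le power_le_one)
  have bound_f: "norm (f u l) \<le> norm x ^ l * B * C" for u l
    unfolding f_def by (rule bound[OF norm_xq])
  have sM: "summable (\<lambda>l. norm x ^ l * B * C)"
    using x by (intro summable_mult2 summable_geometric) auto
  have sf: "summable (f u)" for u
    by (rule summable_comparison_test'[OF sM]) (rule bound_f)
  have step: "suminf (f u) = suminf (f (Suc u))" for u
  proof -
    define g where "g = (\<lambda>l. (x * q ^ u) ^ l * (qtau q l)\<^sup>2 * rqpoch q q (int l - 1) * rqpoch x q (int (u + l)))"
    define h where "h = (\<lambda>l. (x * q ^ Suc u) ^ l * (qtau q l)\<^sup>2 * rqpoch q q (int l) * rqpoch x q (int (u + l)))"
    have fgh: "f u l = g l + h l" for l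
    proof -
      have a: "rqpoch q q (int l - 1) = (1 - q ^ l) * rqpoch q q (int l)" using pr[of "int l"] by simp
      show ?thesis unfolding f_def g_def h_def a by (simp add: power_mult_distrib ring_distribs)
    qed
    have hS: "h l + g (Suc l) = f (Suc u) l" for l
    proof -
      have i: "u + Suc l = Suc u + l" by simp
      have "g (Suc l) = x * q ^ (u + l) * f (Suc u) l"
        unfolding g_def f_def i
        by (simp add: qtau_Suc power_mult_distrib power_add power2_eq_square flip: power_mult)
      moreover have "h l = (1 - x * q ^ (u + l)) * f (Suc u) l"
        unfolding h_def f_def px[of "u + l"] by simp
      ultimately show ?thesis by (simp add: algebra_simps)
    qed
    have g0: "g 0 = 0" using q0 by (simp add: g_def rqpoch_q_neg)
    have "norm (h l) \<le> norm x ^ l * B * C" for l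
      unfolding h_def by (rule bound[OF norm_xq])
    then have sh: "summable h" by (intro summable_comparison_test'[OF sM])
    have sg: "summable g" using summable_diff[OF sf[of u] sh] by (simp add: fgh)
    have "suminf (f u) = suminf g + suminf h"
      using suminf_add[OF sg sh] by (simp flip: fgh)
    also have "suminf g = (\<Sum>l. g (Suc l))"
      using suminf_split_head[OF sg] g0 by simp
    also have "\<dots> + suminf h = suminf (f (Suc u))"
      using suminf_add[OF sh, of "\<lambda>l. g (Suc l)"] sg by (simp add: hS summable_Suc_iff add.commute)
    finally show ?thesis .
  qed
  have const: "suminf (f u) = suminf (f 0)" for u
  proof (induction u)
    case (Suc u)
    then show ?case using step[of u] by simp
  qed simp
  (* Since x q^u tends to 0, only the term l = 0 survives; the bound above dominates all u at once. *)
  have lim: "(\<lambda>u. f u l) \<longlonglongrightarrow> (if l = 0 then 1 / qpoch_inf x q else 0)" for l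
  proof -
    have 1: "(\<lambda>u. rqpoch x q (int (u + l))) \<longlonglongrightarrow> 1 / qpoch_inf x q"
      using LIMSEQ_ignore_initial_segment[OF rqpoch_tendsto[OF q(2) nx], of l] by simp
    have "(\<lambda>u. q ^ u) \<longlonglongrightarrow> 0" using q(2) by (rule LIMSEQ_power_zero)
    then have 2: "(\<lambda>u. (x * q ^ u) ^ l) \<longlonglongrightarrow> (x * 0) ^ l"
      by (intro tendsto_power tendsto_mult tendsto_const)
    have "(\<lambda>u. f u l) \<longlonglongrightarrow> (x * 0) ^ l * (qtau q l)\<^sup>2 * rqpoch q q (int l) * (1 / qpoch_inf x q)"
      unfolding f_def by (intro tendsto_mult 1 2 tendsto_const)
    then show ?thesis by (cases "l = 0") (auto simp: power_0_left)
  qed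
  have "(\<lambda>u. suminf (f u)) \<longlonglongrightarrow> suminf (\<lambda>l. if l = 0 then 1 / qpoch_inf x q else 0)"
  proof -
    have "\<forall>\<^sub>F (l, u) in sequentially \<times>\<^sub>F sequentially. norm (f u l) \<le> norm x ^ l * B * C"
      using bound_f by (auto intro: always_eventually)
    from tannerys_theorem[of "\<lambda>l u. f u l", OF lim this sM] show ?thesis by simp
  qed
  moreover have "suminf (\<lambda>l::nat. if l = 0 then 1 / qpoch_inf x q else 0) = 1 / qpoch_inf x q"
    by (subst suminf_finite[of "{0}"]) auto
  moreover have "(\<lambda>u. suminf (f u)) = (\<lambda>_. suminf (f 0))"
    by (rule ext) (rule const)
  ultimately have "suminf (f 0) = 1 / qpoch_inf x q"
    by (simp add: LIMSEQ_const_iff)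
  then show ?thesis using summable_sums[OF sf[of u]] const[of u] by (simp add: f_def)
qed

section \<open>The coefficient identity\<close>

lemma bij_betw_antidiagonals:
  "bij_betw (\<lambda>(n, u). (n + u, u)) UNIV (SIGMA t:(UNIV :: nat set). {..t})"
  by (rule bij_betwI[where g = "\<lambda>(t, u). (t - u, u)"]) auto

lemma summable_on_Times_mult:
  fixes f :: "'a \<Rightarrow> real" and g :: "'b \<Rightarrow> real"
  assumes f: "f summable_on A" "\<And>x. x \<in> A \<Longrightarrow> f x \<ge> 0"
    and g: "g summable_on B" "\<And>y. y \<in> B \<Longrightarrow> g y \<ge> 0"
  shows "(\<lambda>(x, y). f x * g y) summable_on (A \<times> B)"
proof (rule summable_on_SigmaI[where g = "\<lambda>x. f x * infsum g B"])
  show "((\<lambda>y. case (x, y) of (x, y) \<Rightarrow> f x * g y) has_sum f x * infsum g B) B" for x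
    using g(1) by (auto intro!: has_sum_cmult_right)
  show "(\<lambda>x. f x * infsum g B) summable_on A"
    using f(1) by (rule summable_on_cmult_left)
qed (use f g in auto)

text \<open>
  For $|x| < |z| < 1$ the left-hand sides are the coefficients of $z^m$ in
  \[ \frac{1}{(z;q)_\infty (x/z;q)_\infty} \sum_k \frac{(z;q)_k\, \tau(k)}{(q;q)_k (x;q)_k} (x/z)^k
     = \frac{1}{(x;q)_\infty (z;q)_\infty}, \]
  which is the summation of ${}_1\phi_1(z; x; q, x/z)$. To avoid comparing Laurent coefficients, the
  computation is done on coefficients: \<open>q_power_expansion\<close> splits the index as $k = u + l$,
  the sum over \<open>l\<close> is \<open>cauchy_sum_shifted\<close>, and the remaining sum over \<open>n\<close> and \<open>u\<close> collapses
  along the antidiagonals $n + u = t$ by \<open>q_binomial_at_one\<close>.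
\<close>

lemma coefficient_sum:
  assumes q: "0 < norm q" "norm q < 1" and x: "norm x < 1" and nx: "\<forall>n::nat. 1 - x * q ^ n \<noteq> 0"
  shows "(\<Sum>\<^sub>\<infinity>(n, k)\<in>UNIV. x ^ (n + k) * q powi ((m + int n + int k) * int k) * qtau q k
      * rqpoch q q (int n) * rqpoch q q (int k) * rqpoch q q (m + int n + int k) * rqpoch x q (int k))
    = rqpoch q q m / qpoch_inf x q"
proof -
  have q0: "q \<noteq> 0" using q by auto
  note nz = one_minus_power_nonzero[OF q(2)]
  obtain B where B: "B > 0" "\<And>n. norm (rqpoch q q (int n)) \<le> B" by (rule rqpoch_bound[OF q(2) nz]) blast
  obtain C where C: "C > 0" "\<And>n. norm (rqpoch x q (int n)) \<le> C" by (rule rqpoch_bound[OF q(2) nx]) blast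
  have B': "norm (rqpoch q q j) \<le> B" for j
  proof (cases "j < 0")
    case True then show ?thesis using B(1) q0 by (simp add: rqpoch_q_neg)
  next
    case False then show ?thesis using B(2)[of "nat j"] by simp
  qed
  define G where "G = (\<lambda>n k l. x ^ (n + k) * qtau q k * qtau q l * rqpoch q q (int l)
     * rqpoch q q (int k - int l) * rqpoch q q (m + int n + int k - int l) * rqpoch q q (int n) * rqpoch x q (int k))"
  define H where "H = (\<lambda>n u l. G n (u + l) l)"
  define T where "T = (SIGMA p:(UNIV :: (nat \<times> nat) set). {..snd p})"
  have bij: "bij_betw (\<lambda>((n, u), l). ((n, u + l), l)) UNIV T"
    unfolding T_def by (rule bij_betwI[where g = "\<lambda>((n, k), l). ((n, k - l), l)"]) auto
  have geo: "(\<lambda>n. norm x ^ n) summable_on UNIV"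
    using x by (intro norm_summable_imp_summable_on) (simp add: summable_geometric)
  have "(\<lambda>((n, u), l). (norm x ^ n * norm x ^ u) * norm x ^ l) summable_on (UNIV \<times> UNIV) \<times> UNIV"
    using summable_on_Times_mult[OF summable_on_Times_mult[OF geo _ geo] _ geo]
    by (simp add: case_prod_unfold)
  then have "(\<lambda>((n, u), l). ((norm x ^ n * norm x ^ u) * norm x ^ l) * (B ^ 4 * C)) summable_on UNIV"
    using summable_on_cmult_left[of _ UNIV "B ^ 4 * C"] by (auto simp: case_prod_unfold)
  then have "(\<lambda>p. norm ((\<lambda>((n, u), l). H n u l) p)) summable_on UNIV"
  proof (rule Infinite_Sum.abs_summable_on_comparison_test')
    fix p :: "(nat \<times> nat) \<times> nat"
    obtain n u l where p: "p = ((n, u), l)" by (metis surj_pair)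
    have "norm (H n u l) \<le> norm x ^ (n + (u + l)) * 1 * 1 * B * B * B * B * C"
      unfolding H_def G_def norm_mult norm_power using B C B'
      by (intro mult_mono mult_nonneg_nonneg zero_le_power norm_ge_zero norm_qtau_le q B' C order.refl)
         (auto intro: less_imp_le)
    then show "norm ((\<lambda>((n, u), l). H n u l) p) \<le> (\<lambda>((n, u), l). ((norm x ^ n * norm x ^ u) * norm x ^ l) * (B ^ 4 * C)) p"
      by (simp add: p power_add eval_nat_numeral mult_ac)
  qed
  then have sH: "(\<lambda>((n, u), l). H n u l) summable_on UNIV" by (rule abs_summable_summable)
  have HG: "(\<lambda>((n, u), l). H n u l) = (\<lambda>p. (\<lambda>((n, k), l). G n k l) ((\<lambda>((n, u), l). ((n, u + l), l)) p))"
    by (auto simp: fun_eq_iff H_def)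
  have sG: "(\<lambda>((n, k), l). G n k l) summable_on T"
    using sH summable_on_reindex_bij_betw[OF bij, of "\<lambda>((n, k), l). G n k l"] unfolding HG by blast
  have "(\<Sum>\<^sub>\<infinity>(n, k)\<in>UNIV. x ^ (n + k) * q powi ((m + int n + int k) * int k) * qtau q k
      * rqpoch q q (int n) * rqpoch q q (int k) * rqpoch q q (m + int n + int k) * rqpoch x q (int k))
    = (\<Sum>\<^sub>\<infinity>p\<in>UNIV. \<Sum>\<^sub>\<infinity>l\<in>{..snd p}. G (fst p) (snd p) l)"
  proof (intro infsum_cong)
    fix p :: "nat \<times> nat"
    obtain n k where p: "p = (n, k)" by fastforce
    have "(\<Sum>l\<le>k. G n k l) = x ^ (n + k) * qtau q k * rqpoch q q (int n) * rqpoch x q (int k) *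
       (\<Sum>l\<le>k. qtau q l * rqpoch q q (int l) * rqpoch q q (int k - int l) * rqpoch q q (m + int n + int k - int l))"
      unfolding sum_distrib_left by (intro sum.cong refl) (simp add: G_def mult_ac)
    also have "\<dots> = x ^ (n + k) * qtau q k * rqpoch q q (int n) * rqpoch x q (int k) *
       (q powi ((m + int n + int k) * int k) * rqpoch q q (m + int n + int k) * rqpoch q q (int k))"
      by (simp only: q_power_expansion[OF q])
    finally show "(case p of (n, k) \<Rightarrow> x ^ (n + k) * q powi ((m + int n + int k) * int k) * qtau q k
      * rqpoch q q (int n) * rqpoch q q (int k) * rqpoch q q (m + int n + int k) * rqpoch x q (int k)) =
      (\<Sum>\<^sub>\<infinity>l\<in>{..snd p}. G (fst p) (snd p) l)"
      by (simp add: p mult_ac)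
  qed
  also have "\<dots> = (\<Sum>\<^sub>\<infinity>p\<in>T. (\<lambda>((n, k), l). G n k l) p)"
    using infsum_Sigma_banach[OF sG[unfolded T_def]] by (simp add: T_def case_prod_unfold)
  also have "\<dots> = (\<Sum>\<^sub>\<infinity>p\<in>UNIV. (\<lambda>((n, u), l). H n u l) p)"
    unfolding HG by (rule infsum_reindex_bij_betw[OF bij, symmetric])
  also have "\<dots> = (\<Sum>\<^sub>\<infinity>p\<in>UNIV. \<Sum>\<^sub>\<infinity>l\<in>UNIV. H (fst p) (snd p) l)"
    using infsum_Sigma_banach[of "\<lambda>((n, u), l). H n u l" UNIV "\<lambda>_. UNIV"] sH
    by (simp add: case_prod_unfold)
  also have "\<dots> = (\<Sum>\<^sub>\<infinity>(n, u)\<in>UNIV. x ^ (n + u) * qtau q u * rqpoch q q (int u) * rqpoch q q (int n)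
      * rqpoch q q (m + int n + int u) / qpoch_inf x q)"
  proof (intro infsum_cong)
    fix p :: "nat \<times> nat"
    obtain n u where p: "p = (n, u)" by fastforce
    define c where "c = x ^ (n + u) * qtau q u * rqpoch q q (int u) * rqpoch q q (int n) * rqpoch q q (m + int n + int u)"
    define f where "f = (\<lambda>l. (x * q ^ u) ^ l * (qtau q l)\<^sup>2 * rqpoch q q (int l) * rqpoch x q (int (u + l)))"
    have Hf: "H n u l = c * f l" for l
      by (simp add: H_def G_def c_def f_def qtau_add power_add power_mult_distrib power2_eq_square
          algebra_simps flip: power_mult)
    have fs: "f sums (1 / qpoch_inf x q)" unfolding f_def by (rule cauchy_sum_shifted[OF q x nx])
    have "(\<lambda>l. H n u l) summable_on UNIV"
      using summable_on_SigmaD1[of "\<lambda>p l. H (fst p) (snd p) l" UNIV "\<lambda>_. UNIV" "(n, u)"] sH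
      by (simp add: case_prod_unfold)
    then have "(\<lambda>l. H n u l) sums (\<Sum>\<^sub>\<infinity>l. H n u l)"
      by (intro has_sum_imp_sums has_sum_infsum)
    moreover have "(\<lambda>l. H n u l) sums (c * (1 / qpoch_inf x q))"
      unfolding Hf by (intro sums_mult fs)
    ultimately have "(\<Sum>\<^sub>\<infinity>l. H n u l) = c * (1 / qpoch_inf x q)" by (rule sums_unique2)
    then show "(\<Sum>\<^sub>\<infinity>l. H (fst p) (snd p) l) = (case p of (n, u) \<Rightarrow> x ^ (n + u) * qtau q u
      * rqpoch q q (int u) * rqpoch q q (int n) * rqpoch q q (m + int n + int u) / qpoch_inf x q)"
      by (simp add: p c_def)
  qed
  also have "\<dots> = (\<Sum>\<^sub>\<infinity>t\<in>(UNIV :: nat set). if t = 0 then rqpoch q q m / qpoch_inf x q else 0)"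
  proof -
    define f where "f = (\<lambda>t u. x ^ t * rqpoch q q (m + int t) / qpoch_inf x q
       * (qtau q u * rqpoch q q (int u) * rqpoch q q (int t - int u)))"
    have e: "(\<lambda>(n, u). x ^ (n + u) * qtau q u * rqpoch q q (int u) * rqpoch q q (int n)
      * rqpoch q q (m + int n + int u) / qpoch_inf x q) = (\<lambda>p. (\<lambda>(t, u). f t u) ((\<lambda>(n, u). (n + u, u)) p))"
      by (auto simp: fun_eq_iff f_def algebra_simps)
    have "(\<lambda>(n, u). norm x ^ n * norm x ^ u) summable_on UNIV \<times> UNIV"
      by (rule summable_on_Times_mult[OF geo _ geo]) auto
    then have "(\<lambda>(n, u). (norm x ^ n * norm x ^ u) * (B ^ 3 / norm (qpoch_inf x q))) summable_on UNIV"
      using summable_on_cmult_left[of _ UNIV "B ^ 3 / norm (qpoch_inf x q)"] by (auto simp: case_prod_unfold)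
    then have "(\<lambda>p. norm ((\<lambda>(t, u). f t u) ((\<lambda>(n, u). (n + u, u)) p))) summable_on UNIV"
    proof (rule Infinite_Sum.abs_summable_on_comparison_test')
      fix p :: "nat \<times> nat"
      obtain n u where p: "p = (n, u)" by fastforce
      have "norm (x ^ (n + u) * qtau q u * rqpoch q q (int u) * rqpoch q q (int n) * rqpoch q q (m + int n + int u))
         \<le> norm x ^ (n + u) * 1 * B * B * B"
        unfolding norm_mult norm_power using B B'
        by (intro mult_mono mult_nonneg_nonneg zero_le_power norm_ge_zero norm_qtau_le q B' order.refl)
           (auto intro: less_imp_le)
      then have "norm (x ^ (n + u) * qtau q u * rqpoch q q (int u) * rqpoch q q (int n) * rqpoch q q (m + int n + int u))
         / norm (qpoch_inf x q) \<le> norm x ^ (n + u) * 1 * B * B * B / norm (qpoch_inf x q)"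
        by (rule divide_right_mono) simp
      then show "norm ((\<lambda>(t, u). f t u) ((\<lambda>(n, u). (n + u, u)) p)) \<le>
         (\<lambda>(n, u). (norm x ^ n * norm x ^ u) * (B ^ 3 / norm (qpoch_inf x q))) p"
        unfolding fun_cong[OF e, symmetric]
        by (simp add: p norm_divide power_add eval_nat_numeral mult_ac)
    qed
    then have "(\<lambda>p. (\<lambda>(t, u). f t u) ((\<lambda>(n, u). (n + u, u)) p)) summable_on UNIV"
      by (rule abs_summable_summable)
    then have sf: "(\<lambda>(t, u). f t u) summable_on (SIGMA t:UNIV. {..t})"
      using summable_on_reindex_bij_betw[OF bij_betw_antidiagonals, of "\<lambda>(t, u). f t u"] by blast
    have "(\<Sum>\<^sub>\<infinity>p\<in>UNIV. (\<lambda>(t, u). f t u) ((\<lambda>(n, u). (n + u, u)) p)) = infsum (\<lambda>(t, u). f t u) (SIGMA t:UNIV. {..t})"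
      by (rule infsum_reindex_bij_betw[OF bij_betw_antidiagonals])
    also have "\<dots> = (\<Sum>\<^sub>\<infinity>t\<in>UNIV. \<Sum>\<^sub>\<infinity>u\<in>{..t}. f t u)"
      using infsum_Sigma'_banach[OF sf] by simp
    also have "\<dots> = (\<Sum>\<^sub>\<infinity>t\<in>(UNIV :: nat set). if t = 0 then rqpoch q q m / qpoch_inf x q else 0)"
    proof (intro infsum_cong)
      fix t :: nat
      have "(\<Sum>u\<le>t. f t u) = x ^ t * rqpoch q q (m + int t) / qpoch_inf x q * (if t = 0 then 1 else 0)"
        unfolding f_def sum_distrib_left[symmetric] q_binomial_at_one[OF q] ..
      then show "(\<Sum>\<^sub>\<infinity>u\<in>{..t}. f t u) = (if t = 0 then rqpoch q q m / qpoch_inf x q else 0)"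
        by simp
    qed
    finally show ?thesis unfolding e .
  qed
  also have "\<dots> = (\<Sum>\<^sub>\<infinity>t\<in>{0::nat}. rqpoch q q m / qpoch_inf x q)"
    by (rule infsum_cong_neutral) auto
  finally show ?thesis by simp
qed

section \<open>Reflection of the parameters\<close>

text \<open>
  Reversing the order of the factors: $1 - q^{1-j+s}/c$ is, up to a monomial, the factor
  $1 - cq^{j-1-s}$, and these are exactly the factors by which $(c;q)_j$ and $(c;q)_{j-n}$ differ.
\<close>

lemma rqpoch_reflect:
  assumes "q \<noteq> 0" "\<forall>n::nat. 1 - c * q ^ n \<noteq> 0" "c \<noteq> 0"
  shows "qpoch (q powi (1 - j) / c) q (int n) * rqpoch c q j
    = qtau q n * q powi ((1 - j) * int n) / c ^ n * rqpoch c q (j - int n)"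
proof (induction n)
  case 0
  show ?case by (simp add: qpoch_def)
next
  case (Suc n)
  have a: "qpoch (q powi (1 - j) / c) q (int (Suc n))
     = (1 - q powi (1 - j) / c * q ^ n) * qpoch (q powi (1 - j) / c) q (int n)"
    unfolding qpoch_nat by simp
  have b: "rqpoch c q (j - int (Suc n)) = (1 - c * q powi (j - int n - 1)) * rqpoch c q (j - int n)"
    using rqpoch_pred[OF assms(1,2), of "j - int n"] by (simp add: algebra_simps)
  have d: "1 - q powi (1 - j) / c * q ^ n = - (q ^ n) * q powi (1 - j) / c * (1 - c * q powi (j - int n - 1))"
    using assms by (simp add: field_simps power_int_diff power_int_add)
  have e: "q powi ((1 - j) * int (Suc n)) = q powi (1 - j) * q powi ((1 - j) * int n)"
    using assms(1) by (simp add: distrib_left flip: power_int_add)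
  have "qpoch (q powi (1 - j) / c) q (int (Suc n)) * rqpoch c q j
     = (1 - q powi (1 - j) / c * q ^ n) * (qpoch (q powi (1 - j) / c) q (int n) * rqpoch c q j)"
    unfolding a by simp
  also have "\<dots> = qtau q (Suc n) * (q powi (1 - j) * q powi ((1 - j) * int n)) / c ^ Suc n
      * ((1 - c * q powi (j - int n - 1)) * rqpoch c q (j - int n))"
    unfolding Suc d qtau_Suc power_Suc by (simp only: times_divide_eq_left times_divide_eq_right divide_divide_eq_left mult_ac)
  finally show ?case unfolding b e .
qed

text \<open>
  Both sides satisfy the same first-order recurrence in \<open>j\<close> and agree at $j = 0$. Going upwards one
  divides by $1 - q^{k+j}$, which is nonzero because $k + j > 0$ there.
\<close>

lemma rqpoch_shift:
  assumes q: "0 < norm q" "norm q < 1"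
  shows "rqpoch q q (int k) * rqpoch (q ^ (k + 1)) q j = rqpoch q q (int k + j)"
proof -
  have q0: "q \<noteq> 0" using q by auto
  note nz = one_minus_power_nonzero[OF q(2)]
  have nzk: "\<forall>n::nat. 1 - q ^ (k + 1) * q ^ n \<noteq> 0"
    using nz[rule_format, of "k + n" for n] by (simp add: power_add mult_ac)
  have p1: "rqpoch q q (int k + (i - 1)) = (1 - q powi (int k + i)) * rqpoch q q (int k + i)" for i
    using rqpoch_pred[OF q0 nz, of "int k + i"] q0 by (simp add: power_int_diff algebra_simps)
  have p2: "rqpoch (q ^ (k + 1)) q (i - 1) = (1 - q powi (int k + i)) * rqpoch (q ^ (k + 1)) q i" for i
    using rqpoch_pred[OF q0 nzk, of i] q0 by (simp add: power_int_diff power_int_add)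
  show ?thesis
  proof (induction j rule: int_induct[of _ 0])
    case base
    show ?case by simp
  next
    case (step1 i)
    obtain n where n: "i = int n" using step1(1) by (metis nonneg_int_cases)
    have "int k + (i + 1) = int (Suc (k + n))" by (simp add: n)
    then have "1 - q powi (int k + (i + 1)) \<noteq> 0"
      using nz[rule_format, of "k + n"] by (simp only: power_int_of_nat power_Suc not_False_eq_True)
    then show ?case using step1(2) p1[of "i + 1"] p2[of "i + 1"] by simp
  next
    case (step2 i)
    show ?case unfolding p1 p2 using step2(2) by (simp add: algebra_simps)
  qed
qed

lemma qpochs_reflect:
  assumes q: "q \<noteq> 0" and "\<forall>c\<in>set cs. c \<noteq> 0" "\<forall>c\<in>set cs. \<forall>n::nat. 1 - c * q ^ n \<noteq> 0"
  shows "qpochs (map (\<lambda>c. q powi (1 - j) / c) cs) q (int n) / qpochs cs q j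
    = (qtau q n * q powi ((1 - j) * int n)) ^ length cs / prod_list cs ^ n / qpochs cs q (j - int n)"
  using assms(2,3)
proof (induction cs)
  case Nil
  show ?case by (simp add: qpochs_def)
next
  case (Cons c cs)
  have "qpochs (map (\<lambda>c. q powi (1 - j) / c) (c # cs)) q (int n) / qpochs (c # cs) q j
     = (qpoch (q powi (1 - j) / c) q (int n) * rqpoch c q j)
       * (qpochs (map (\<lambda>c. q powi (1 - j) / c) cs) q (int n) / qpochs cs q j)"
    by (simp add: qpochs_def rqpoch_def)
  also have "qpoch (q powi (1 - j) / c) q (int n) * rqpoch c q j
      = qtau q n * q powi ((1 - j) * int n) / c ^ n * rqpoch c q (j - int n)"
    using Cons.prems q by (intro rqpoch_reflect) auto
  also have "qpochs (map (\<lambda>c. q powi (1 - j) / c) cs) q (int n) / qpochs cs q j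
      = (qtau q n * q powi ((1 - j) * int n)) ^ length cs / prod_list cs ^ n / qpochs cs q (j - int n)"
    using Cons by auto
  finally show ?case
    by (simp add: qpochs_def rqpoch_def power_mult_distrib)
qed

text \<open>
  After reflecting all parameters, the monomials produced by the lists, by the inner argument and by the
  single factor \<open>qtau q n\<close> cancel, and the parameters enter only through the value at
  $m = i - k - n$ of one bilateral sequence.
\<close>

lemma rhs_term_eq:
  assumes q: "0 < norm q" "norm q < 1"
    and len: "length as = length bs + 1"
    and as0: "\<forall>a\<in>set as. a \<noteq> 0" and bs0: "\<forall>b\<in>set bs. b \<noteq> 0" and y0: "y \<noteq> 0"
    and asn: "\<forall>a\<in>set as. \<forall>n::nat. 1 - a * q ^ n \<noteq> 0"
    and bsn: "\<forall>b\<in>set bs. \<forall>n::nat. 1 - b * q ^ n \<noteq> 0"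
    and m: "m = int i - int k - int n"
  shows "outer_coeff as bs q x y i k
      * qhyp_term (0 # reflected q i k bs) (reflected q i k as) q (inner_arg as bs q x y i k) n
    = qpochs as q m / qpochs bs q m * y powi m
      * (x ^ (n + k) * q powi ((m + int n + int k) * int k) * qtau q k
      * rqpoch q q (int n) * rqpoch q q (int k) * rqpoch q q (m + int n + int k) * rqpoch x q (int k))"
proof -
  have q0: "q \<noteq> 0" using q by auto
  define j where "j = int i - int k"
  (* V is the monomial that each reflected parameter contributes; the r + 1 upper and r lower parameters
     leave a single 1/V, which the twist of the inner series and the power of q in its argument cancel. *)
  define V where "V = qtau q n * q powi ((1 - j) * int n)"
  have V0: "V \<noteq> 0" using q0 by (simp add: V_def qtau_def)
  have e1: "1 + int k - int i = 1 - j" by (simp add: j_def)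
  have m': "m = j - int n" by (simp add: m j_def)
  have pa: "prod_list as \<noteq> 0" and pb: "prod_list bs \<noteq> 0" using as0 bs0 by (auto simp: prod_list_zero_iff)
  define RA RB where "RA = qpochs (reflected q i k as) q (int n)" and "RB = qpochs (reflected q i k bs) q (int n)"
  have rb: "RB / qpochs bs q j = V ^ length bs / prod_list bs ^ n / qpochs bs q m"
    unfolding RB_def V_def m' reflected_def e1 by (rule qpochs_reflect[OF q0 bs0 bsn])
  have ra: "RA / qpochs as q j = V ^ length as / prod_list as ^ n / qpochs as q m"
    unfolding RA_def V_def m' reflected_def e1 by (rule qpochs_reflect[OF q0 as0 asn])
  have ratio: "(RB / qpochs bs q j) / (RA / qpochs as q j) * V * (prod_list bs / prod_list as) ^ n
      = qpochs as q m / qpochs bs q m"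
    unfolding ra rb len using V0 pa pb by (simp add: power_divide)
  have arg: "inner_arg as bs q x y i k ^ n
      = x ^ n * (prod_list bs / prod_list as) ^ n * q powi ((1 - j) * int n) / y ^ n"
    unfolding inner_arg_def e1 by (simp add: power_mult_distrib power_divide power_int_mult)
  have inner: "qhyp_term (0 # reflected q i k bs) (reflected q i k as) q (inner_arg as bs q x y i k) n
     = RB / RA * V * x ^ n * (prod_list bs / prod_list as) ^ n / y ^ n * rqpoch q q (int n)"
  proof -
    have "qpochs (0 # reflected q i k bs) q (int n) = RB" by (simp add: RB_def qpochs_def qpoch_nat)
    moreover have "int (length (reflected q i k as)) + 1 - int (length (0 # reflected q i k bs)) = 1"
      by (simp add: reflected_def len)
    ultimately show ?thesis unfolding qhyp_term_def arg V_def RA_def[symmetric] by (simp add: rqpoch_def divide_inverse mult_ac)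
  qed
  have outer: "outer_coeff as bs q x y i k
      = x ^ k * q ^ (i * k) * qtau q k * rqpoch q q (int k) * rqpoch x q (int k)
        * (rqpoch q q (int k) * rqpoch (q ^ (k + 1)) q j) * (qpochs as q j / qpochs bs q j) * y powi j"
    by (simp add: outer_coeff_def qpochs_def rqpoch_def j_def)
  have "outer_coeff as bs q x y i k
      * qhyp_term (0 # reflected q i k bs) (reflected q i k as) q (inner_arg as bs q x y i k) n
    = ((RB / qpochs bs q j) / (RA / qpochs as q j) * V * (prod_list bs / prod_list as) ^ n)
       * (y powi j / y ^ n)
       * (x ^ k * x ^ n * q ^ (i * k) * qtau q k * rqpoch q q (int n) * rqpoch q q (int k)
          * (rqpoch q q (int k) * rqpoch (q ^ (k + 1)) q j) * rqpoch x q (int k))"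
    unfolding outer inner by (simp add: divide_inverse mult_ac)
  also have "y powi j / y ^ n = y powi m" using y0 by (simp add: m' power_int_diff)
  also have "rqpoch q q (int k) * rqpoch (q ^ (k + 1)) q j = rqpoch q q (m + int n + int k)"
    unfolding rqpoch_shift[OF q] by (simp add: m' add.commute)
  also have "q ^ (i * k) = q powi ((m + int n + int k) * int k)"
    by (simp add: m flip: of_nat_mult)
  finally show ?thesis unfolding ratio by (simp add: power_add mult_ac)
qed

section \<open>The expansion of the hypergeometric series\<close>

lemma qpochs_0 [simp]: "qpochs cs q 0 = 1"
  by (induction cs) (simp_all add: qpochs_def qpoch_def)

theorem theorem3p19:
  fixes q x y :: complex and as bs :: "complex list" and r :: nat
  assumes "0 < norm q" and "norm q < 1"
    and "r \<ge> 1" and "length as = r + 1" and "length bs = r"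
    and "\<forall>a\<in>set as. a \<noteq> 0" and "\<forall>b\<in>set bs. b \<noteq> 0" and "x \<noteq> 0" and "y \<noteq> 0"
    and no_zero_bs: "\<forall>b\<in>set bs. \<forall>n::nat. 1 - b * q ^ n \<noteq> 0"
    and no_zero_x: "\<forall>n::nat. 1 - x * q ^ n \<noteq> 0"
    and no_zero_as: "\<forall>a\<in>set as. \<forall>m::int. 1 - q powi m / a \<noteq> 0"
    and lhs_abs_conv: "summable (\<lambda>n. norm (qhyp_term as bs q y n))"
    and rhs_abs_conv:
      "(\<lambda>(i, k, n). norm (outer_coeff as bs q x y i k
          * qhyp_term (0 # reflected q i k bs) (reflected q i k as) q
              (inner_arg as bs q x y i k) n)) summable_on (UNIV :: (nat \<times> nat \<times> nat) set)"
  shows "qhyp as bs q y =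
    qpoch_inf x q *
      (\<Sum>\<^sub>\<infinity>(i, k)\<in>(UNIV :: (nat \<times> nat) set). outer_coeff as bs q x y i k
          * qhyp (0 # reflected q i k bs) (reflected q i k as) q (inner_arg as bs q x y i k))"
proof -
  note q = assms(1,2)
  have q0: "q \<noteq> 0" using q by auto
  note nz = one_minus_power_nonzero[OF q(2)]
  have asn: "\<forall>a\<in>set as. \<forall>n::nat. 1 - a * q ^ n \<noteq> 0"
  proof (intro ballI allI notI)
    fix a n assume a: "a \<in> set as" "1 - a * q ^ n = 0"
    then have "1 - q powi (- int n) / a = 0"
      using assms(6) q0 by (auto simp: power_int_minus field_simps)
    then show False using no_zero_as a(1) by blast
  qed
  define A where "A = (\<lambda>m. qpochs as q m / qpochs bs q m)"
  define K where "K = (\<lambda>m n k. x ^ (n + k) * q powi ((m + int n + int k) * int k) * qtau q k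
      * rqpoch q q (int n) * rqpoch q q (int k) * rqpoch q q (m + int n + int k) * rqpoch x q (int k))"
  define inner where "inner = (\<lambda>i k n. qhyp_term (0 # reflected q i k bs) (reflected q i k as) q
              (inner_arg as bs q x y i k) n)"
  define F where "F = (\<lambda>i k n. outer_coeff as bs q x y i k * inner i k n)"
  have F: "F i k n = A m * y powi m * K m n k" if "m = int i - int k - int n" for i k n m
    unfolding F_def inner_def A_def K_def
    using assms asn by (intro rhs_term_eq that) auto
  have absF: "(\<lambda>(i, k, n). norm (F i k n)) summable_on UNIV"
    using rhs_abs_conv by (simp add: F_def inner_def)
  (* The terms with k = 0 and i = n have m = 0, so they do not involve the parameters:
     they are x^n / (q;q)_n^2. Their summability forces |x| < 1. *)
  have x: "norm x < 1"
  proof -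
    obtain N where N: "N > 0" "\<And>n. norm (qpoch q q (int n)) \<le> N"
      using convergent_imp_Bseq[OF convergentI[OF qpoch_tendsto(1)[OF q(2) nz]]] unfolding Bseq_def by auto
    have inj: "inj (\<lambda>n::nat. (n, 0::nat, n))" by (simp add: inj_on_def)
    have "(\<lambda>(i, k, n). norm (F i k n)) summable_on range (\<lambda>n. (n, 0, n))"
      by (rule summable_on_subset_banach[OF absF]) simp
    then have "(\<lambda>n. norm (F n 0 n)) summable_on UNIV"
      unfolding summable_on_reindex[OF inj] by (simp add: o_def)
    then have s: "summable (\<lambda>n. norm (F n 0 n))"
      by (simp add: summable_on_UNIV_nonneg_real_iff)
    have "summable (\<lambda>n. norm x ^ n)"
    proof (rule summable_comparison_test'[OF summable_mult[OF s, of "N\<^sup>2"]])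
      fix n
      have "qpoch q q (int n) \<noteq> 0" using nz by (auto simp: qpoch_nat)
      moreover have "F n 0 n = x ^ n * rqpoch q q (int n) * rqpoch q q (int n)"
        using F[of 0 n 0 n] by (simp add: A_def K_def)
      ultimately have "x ^ n = (qpoch q q (int n))\<^sup>2 * F n 0 n"
        by (simp add: rqpoch_def power2_eq_square)
      then have "norm (x ^ n) = (norm (qpoch q q (int n)))\<^sup>2 * norm (F n 0 n)"
        by (simp add: norm_mult norm_power)
      also have "\<dots> \<le> N\<^sup>2 * norm (F n 0 n)"
        using N by (intro mult_right_mono power_mono) auto
      finally show "norm (norm x ^ n) \<le> N\<^sup>2 * norm (F n 0 n)" by (simp add: norm_power)
    qed
    then show ?thesis by (simp add: summable_geometric_iff)
  qed
  define W where "W = (\<lambda>(m, n, k). A m * y powi m * K m n k)"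
  define T where "T = {(m, n, k). m + int n + int k \<ge> 0}"
  have bij1: "bij_betw (\<lambda>((i, k), n). (i, k, n)) (UNIV :: ((nat \<times> nat) \<times> nat) set) UNIV"
    by (rule bij_betwI[where g = "\<lambda>(i, k, n). ((i, k), n)"]) auto
  define \<phi> :: "(nat \<times> nat) \<times> nat \<Rightarrow> int \<times> nat \<times> nat"
    where "\<phi> = (\<lambda>((i, k), n). (int i - int k - int n, n, k))"
  have bij2: "bij_betw \<phi> UNIV T"
    unfolding T_def \<phi>_def by (rule bij_betwI[where g = "\<lambda>(m, n, k). ((nat (m + int n + int k), k), n)"]) auto
  have FW: "(\<lambda>((i, k), n). F i k n) = (\<lambda>p. W (\<phi> p))"
    by (auto simp: fun_eq_iff W_def \<phi>_def F[OF refl])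
  have "(\<lambda>p. norm ((\<lambda>((i, k), n). F i k n) p)) summable_on UNIV"
    using absF summable_on_reindex_bij_betw[OF bij1, of "\<lambda>(i, k, n). norm (F i k n)"]
    by (simp add: case_prod_unfold)
  then have sF: "(\<lambda>((i, k), n). F i k n) summable_on UNIV" by (rule abs_summable_summable)
  (* The index i = m + n + k may be negative off T, but then 1/(q;q)_i = 0,
     so the sum over T extends to all integers m. *)
  have W0: "W p = 0" if "p \<notin> T" for p
  proof -
    obtain m n k where p: "p = (m, n, k)" by (metis surj_pair)
    then have "rqpoch q q (m + int n + int k) = 0"
      using that q0 by (intro rqpoch_q_neg) (auto simp: T_def)
    then show ?thesis by (simp add: p W_def K_def)
  qed
  have sW: "W summable_on UNIV"
  proof -
    have "W summable_on T" using sF summable_on_reindex_bij_betw[OF bij2, of W] by (simp add: FW)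
    then show ?thesis by (subst summable_on_cong_neutral[of T UNIV W W]) (auto simp: W0)
  qed
  (* The inner series is known to converge only where its coefficient is nonzero;
     a vanishing coefficient makes both sides zero. *)
  have inner_sum: "outer_coeff as bs q x y i k
      * qhyp (0 # reflected q i k bs) (reflected q i k as) q (inner_arg as bs q x y i k)
     = (\<Sum>\<^sub>\<infinity>n. F i k n)" for i k
  proof (cases "outer_coeff as bs q x y i k = 0")
    case False
    have "(\<lambda>n. F i k n) summable_on UNIV"
      using summable_on_SigmaD1[of "\<lambda>p n. F (fst p) (snd p) n" UNIV "\<lambda>_. UNIV" "(i, k)"] sF
      by (simp add: case_prod_unfold)
    then have s: "(\<lambda>n. F i k n) sums (\<Sum>\<^sub>\<infinity>n. F i k n)" by (intro has_sum_imp_sums has_sum_infsum)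
    have "summable (inner i k)"
      using s False by (simp add: F_def sums_iff summable_cmult_iff)
    then have "(\<lambda>n. F i k n) sums (outer_coeff as bs q x y i k * suminf (inner i k))"
      unfolding F_def by (intro sums_mult summable_sums)
    then show ?thesis using sums_unique2[OF s] by (simp add: qhyp_def inner_def)
  qed (simp add: F_def)
  have "(\<Sum>\<^sub>\<infinity>(i, k)\<in>UNIV. outer_coeff as bs q x y i k
          * qhyp (0 # reflected q i k bs) (reflected q i k as) q (inner_arg as bs q x y i k))
     = (\<Sum>\<^sub>\<infinity>(i, k)\<in>UNIV. \<Sum>\<^sub>\<infinity>n. F i k n)"
    by (simp only: inner_sum)
  also have "\<dots> = infsum (\<lambda>((i, k), n). F i k n) UNIV"
    using infsum_Sigma_banach[of "\<lambda>((i, k), n). F i k n" UNIV "\<lambda>_. UNIV"] sF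
    by (simp add: case_prod_unfold)
  also have "\<dots> = infsum W T"
    unfolding FW by (rule infsum_reindex_bij_betw[OF bij2])
  also have "\<dots> = infsum W UNIV"
    by (rule infsum_cong_neutral) (auto simp: W0)
  also have "\<dots> = (\<Sum>\<^sub>\<infinity>m. \<Sum>\<^sub>\<infinity>p. W (m, p))"
    using infsum_Sigma_banach[of W UNIV "\<lambda>_. UNIV"] sW by simp
  also have "\<dots> = (\<Sum>\<^sub>\<infinity>m. A m * y powi m * rqpoch q q m / qpoch_inf x q)"
  proof (intro infsum_cong)
    fix m :: int
    have "(\<Sum>\<^sub>\<infinity>p. W (m, p)) = (\<Sum>\<^sub>\<infinity>p. A m * y powi m * (\<lambda>(n, k). K m n k) p)"
      by (simp add: W_def case_prod_unfold)
    also have "\<dots> = A m * y powi m * (\<Sum>\<^sub>\<infinity>(n, k)\<in>UNIV. K m n k)"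
      by (rule infsum_cmult_right')
    also have "(\<Sum>\<^sub>\<infinity>(n, k)\<in>UNIV. K m n k) = rqpoch q q m / qpoch_inf x q"
      unfolding K_def by (rule coefficient_sum[OF q x no_zero_x])
    finally show "(\<Sum>\<^sub>\<infinity>p. W (m, p)) = A m * y powi m * rqpoch q q m / qpoch_inf x q" by simp
  qed
  also have "\<dots> = (\<Sum>\<^sub>\<infinity>m\<in>range int. A m * y powi m * rqpoch q q m / qpoch_inf x q)"
  proof (rule infsum_cong_neutral)
    fix m assume "m \<in> UNIV - range int"
    then have "m < 0" by (metis DiffD2 nonneg_int_cases not_le rangeI)
    then show "A m * y powi m * rqpoch q q m / qpoch_inf x q = 0" using q0 by (simp add: rqpoch_q_neg)
  qed auto
  also have "\<dots> = (\<Sum>\<^sub>\<infinity>n. qhyp_term as bs q y n / qpoch_inf x q)"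
    by (subst infsum_reindex) (simp_all add: inj_on_def o_def qhyp_term_def assms A_def rqpoch_def)
  also have "\<dots> = (\<Sum>\<^sub>\<infinity>n. qhyp_term as bs q y n) / qpoch_inf x q"
    unfolding divide_inverse by (rule infsum_cmult_left')
  also have "(\<Sum>\<^sub>\<infinity>n. qhyp_term as bs q y n) = qhyp as bs q y"
    unfolding qhyp_def
    by (intro infsumI norm_summable_imp_has_sum lhs_abs_conv summable_sums summable_norm_cancel[OF lhs_abs_conv])
  finally show ?thesis using qpoch_tendsto(2)[OF q(2) no_zero_x] by simp
qed

end
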